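(* Let $E=\{x_1,\dots,x_n\}$ be a set of cardinality $n\ge 3$, and let $\sigma_{n-1}$ be a permutation of the set of all $(n-1)$-element subsets of $E$. Then there exists a permutation $\sigma$ of $E$ such that $\sigma_{n-1}(\chi)=\sigma(\chi)$ (the image of $\chi$ under $\sigma$) for every $\chi\subseteq E$ with $|\chi|=n-1$. Moreover, $\sigma$ satisfies $\sigma(A\cap B)=\sigma_{n-1}(A)\cap\sigma_{n-1}(B)$ for all $A,B\subseteq E$ with $|A|=|B|=n-1$, and consequently, for every $x_i\in E$, $$\{\sigma(x_i)\}=\bigcap_{j\in\{1,\dots,n\}\setminus\{i\}}\sigma_{n-1}(E\setminus\{x_j\}).$$
   Context: For a permutation $\sigma$ of $E$ and $\chi\subseteq E$, $\sigma(\chi)=\{\sigma(x):x\in\chi\}$. *)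

theory Defs
  imports Main "HOL-Combinatorics.Permutations"
begin

end

theory Submission
  imports Defs
begin

text \<open>Complementation identifies the \<open>(n - 1)\<close>-subsets of \<open>E\<close> with the points of \<open>E\<close>; the
  required permutation is the conjugate of \<open>\<tau>\<close> under this identification.\<close>

lemma bij_betw_complement_point:
  assumes "finite E" and "E \<noteq> {}"
  shows "bij_betw (\<lambda>y. E - {y}) E {\<chi>. \<chi> \<subseteq> E \<and> card \<chi> = card E - 1}"
  unfolding bij_betw_def
proof
  show "inj_on (\<lambda>y. E - {y}) E"
    by (auto simp: inj_on_def)
  show "(\<lambda>y. E - {y}) ` E = {\<chi>. \<chi> \<subseteq> E \<and> card \<chi> = card E - 1}"
  proof (intro equalityI subsetI)
    fix \<chi> assume "\<chi> \<in> {\<chi>. \<chi> \<subseteq> E \<and> card \<chi> = card E - 1}"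
    then have \<chi>: "\<chi> \<subseteq> E" "card \<chi> = card E - 1" by auto
    \<comment> \<open>Since \<open>E\<close> is nonempty, the truncated subtraction
      \<open>card E - 1\<close> is a genuine one, so exactly one point is left out of
      \<open>\<chi>\<close>; that point is the preimage.\<close>
    have "card (E - \<chi>) = 1"
      using \<chi> assms by (simp add: card_Diff_subset finite_subset card_gt_0_iff Suc_leI)
    then obtain y where "E - \<chi> = {y}" by (rule card_1_singletonE)
    then have "y \<in> E" "\<chi> = E - {y}" using \<chi>(1) by auto
    then show "\<chi> \<in> (\<lambda>y. E - {y}) ` E" by blast
  qed (use assms in auto)
qed

theorem mainTheorem1:
  fixes E :: "'a set" and x :: "nat \<Rightarrow> 'a" and n :: nat
    and \<tau> :: "'a set \<Rightarrow> 'a set"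
  assumes "n \<ge> 3"
    and "E = x ` {1..n}"
    and "card E = n"
    and "\<tau> permutes {\<chi>. \<chi> \<subseteq> E \<and> card \<chi> = n - 1}"
  shows "\<exists>\<sigma>. \<sigma> permutes E
    \<and> (\<forall>\<chi>. \<chi> \<subseteq> E \<and> card \<chi> = n - 1 \<longrightarrow> \<tau> \<chi> = \<sigma> ` \<chi>)
    \<and> (\<forall>A B. A \<subseteq> E \<and> B \<subseteq> E \<and> card A = n - 1 \<and> card B = n - 1
          \<longrightarrow> \<sigma> ` (A \<inter> B) = \<tau> A \<inter> \<tau> B)
    \<and> (\<forall>i\<in>{1..n}. {\<sigma> (x i)} = (\<Inter>j\<in>{1..n} - {i}. \<tau> (E - {x j})))"
proof -
  let ?S = "{\<chi>. \<chi> \<subseteq> E \<and> card \<chi> = n - 1}"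
  let ?c = "\<lambda>y. E - {y}"
  have fin: "finite E" using assms(2) by simp
  have "E \<noteq> {}" using assms(1,3) by auto
  then have c: "bij_betw ?c E ?S"
    using bij_betw_complement_point[OF fin] assms(3) by simp
  \<comment> \<open>\<open>g y\<close> is the single point of \<open>E\<close> that
    \<open>\<tau> (E - {y})\<close> omits.\<close>
  define g where "g = inv_into E ?c \<circ> \<tau> \<circ> ?c"
  \<comment> \<open>\<open>permutes\<close> demands the identity outside \<open>E\<close>, where the
    value of \<open>inv_into\<close> is uncontrolled.\<close>
  define \<sigma> where "\<sigma> y = (if y \<in> E then g y else y)" for y
  have \<tau>: "bij_betw \<tau> ?S ?S" using assms(4) by (rule permutes_imp_bij)
  have "bij_betw g E E"
    unfolding g_def by (intro bij_betw_trans[OF bij_betw_trans[OF c \<tau>, folded comp_assoc]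
          bij_betw_inv_into[OF c], folded comp_assoc])
  then have "bij_betw \<sigma> E E"
    by (rule bij_betw_cong[THEN iffD1, rotated]) (simp add: \<sigma>_def)
  then have perm: "\<sigma> permutes E"
    by (rule bij_imp_permutes) (simp add: \<sigma>_def)
  \<comment> \<open>The conjugation read backwards; everything below uses \<open>\<sigma>\<close>
    only through this equation and its being a permutation of \<open>E\<close>.\<close>
  have \<sigma>: "\<tau> (E - {y}) = E - {\<sigma> y}" if "y \<in> E" for y
  proof -
    have "\<tau> (?c y) \<in> ?S"
      using c \<tau> that by (meson bij_betwE)
    then show ?thesis
      using bij_betw_inv_into_right[OF c] that by (simp add: \<sigma>_def g_def)
  qed
  have inj: "inj \<sigma>" using perm by (rule permutes_inj)
  have img: "\<tau> \<chi> = \<sigma> ` \<chi>" if "\<chi> \<in> ?S" for \<chi>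
  proof -
    obtain y where y: "y \<in> E" "\<chi> = E - {y}"
      using c \<open>\<chi> \<in> ?S\<close> unfolding bij_betw_def by blast
    \<comment> \<open>By injectivity the image of a difference is the difference of the images, and
      \<open>\<sigma>\<close> maps \<open>E\<close> onto itself, so \<open>\<sigma>\<close> also
      sends \<open>E - {y}\<close> to \<open>E - {\<sigma> y}\<close>.\<close>
    then show ?thesis
      using \<sigma> permutes_image[OF perm] by (simp add: image_set_diff[OF inj])
  qed
  \<comment> \<open>The enumeration has no repetitions because its image has as many elements as its
    index set.\<close>
  have x: "inj_on x {1..n}"
    using assms(2,3) by (simp add: eq_card_imp_inj_on)
  have pt: "{\<sigma> (x i)} = (\<Inter>j\<in>{1..n} - {i}. \<tau> (E - {x j}))" if i: "i \<in> {1..n}" for i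
  proof (intro equalityI subsetI)
    fix w assume "w \<in> {\<sigma> (x i)}"
    moreover have "\<sigma> (x i) \<in> \<tau> (E - {x j})" if j: "j \<in> {1..n} - {i}" for j
    proof -
      have "x i \<in> E" "x j \<in> E" using i j assms(2) by auto
      moreover have "x i \<noteq> x j" using i j inj_onD[OF x] by blast
      ultimately show ?thesis
        by (simp add: \<sigma> permutes_in_image[OF perm] inj_eq[OF inj])
    qed
    ultimately show "w \<in> (\<Inter>j\<in>{1..n} - {i}. \<tau> (E - {x j}))" by blast
  next
    fix w assume w: "w \<in> (\<Inter>j\<in>{1..n} - {i}. \<tau> (E - {x j}))"
    have ne: "w \<in> E \<and> w \<noteq> \<sigma> (x j)" if "j \<in> {1..n} - {i}" for j
      using w that assms(2) \<sigma>[of "x j"] by blast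
    \<comment> \<open>Some index other than \<open>i\<close> must exist: otherwise the intersection
      would be over the empty family, hence \<open>UNIV\<close>, and \<open>w \<in> E\<close> would
      not follow.\<close>
    have "(if i = 1 then 2 else 1) \<in> {1..n} - {i}"
      using assms(1) by auto
    \<comment> \<open>Now \<open>w\<close> is \<open>\<sigma> (x k)\<close> for some index
      \<open>k\<close>, and \<open>ne\<close> rules out every \<open>k\<close> except
      \<open>i\<close>.\<close>
    then have "w \<in> \<sigma> ` x ` {1..n}"
      using ne permutes_image[OF perm] assms(2) by metis
    then show "w \<in> {\<sigma> (x i)}" using ne by blast
  qed
  show ?thesis
  proof (intro exI[of _ \<sigma>] conjI allI impI ballI)
    fix A B assume "A \<subseteq> E \<and> B \<subseteq> E \<and> card A = n - 1 \<and> card B = n - 1"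
    then show "\<sigma> ` (A \<inter> B) = \<tau> A \<inter> \<tau> B"
      by (simp add: img image_Int[OF inj])
  qed (use perm img pt in auto)
qed

end
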